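(* Let $0<q<p$ be real, $n\ge0$ an integer, $s>0$, and let $f:(0,\infty)\to\mathbb C$ be a function whose $(p,q)$-Laplace transform of the second kind $F(\sigma)=\mathcal L_{p,q}\{f(t)\}(\sigma)$ converges at all the points $\sigma=(q/p)^ks$, $0\le k\le n$. Then $$\mathcal L_{p,q}\{t^nf(t)\}(s)=(-1)^np^{\binom n2}\,\frac{\partial_{p,q}^{\,n}}{\partial_{p,q}s^n}\left[F(p^{-n}s)\right].$$
   Context: Let $0<q<p$ be real numbers. For an integer $n\ge 0$, $[n]_{p,q}=\frac{p^n-q^n}{p-q}$, $[n]_{p,q}!=\prod_{k=1}^n[k]_{p,q}$, $[0]_{p,q}!=1$. The $(p,q)$-exponentials are $E_{p,q}(z)=\sum_{n\ge0}\frac{q^{\binom n2}}{[n]_{p,q}!}z^n$ (entire) and $e_{p,q}(z)=\sum_{n\ge0}\frac{p^{\binom n2}}{[n]_{p,q}!}z^n$; the latter series converges for $|z|<p/(p-q)$ and $e_{p,q}$ is extended meromorphically to $\mathbb C$ by $e_{p,q}(z)=1/E_{p,q}(-z)$. The improper $(p,q)$-integral of $f$ is $\int_0^\infty f(x)\,d_{p,q}x=(p-q)\sum_{j=-\infty}^{\infty}\frac{q^j}{p^{j+1}}f\!\left(\frac{q^j}{p^{j+1}}\right)$; it converges if both the sum over $j\ge0$ and the sum over $j<0$ converge. The $(p,q)$-Laplace transform of the second kind is $\mathcal L_{p,q}\{f(t)\}(s)=\int_0^\infty f(t)e_{p,q}(-pts)\,d_{p,q}t$, $s>0$. The $(p,q)$-derivative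 in $s$ is $\frac{\partial_{p,q}}{\partial_{p,q}s}g(s)=\frac{g(ps)-g(qs)}{(p-q)s}$ for $s\neq0$, and $\frac{\partial_{p,q}^{\,n}}{\partial_{p,q}s^n}$ is its $n$-fold iterate (identity for $n=0$). The expression $\frac{\partial_{p,q}^{\,n}}{\partial_{p,q}s^n}[F(p^{-n}s)]$ means that the operator is applied to the function $s\mapsto F(p^{-n}s)$; it only involves the values of $F$ at the points $(q/p)^ks$, $0\le k\le n$. *)

theory Defs
  imports Complex_Main
begin

definition pq_num :: "real \<Rightarrow> real \<Rightarrow> nat \<Rightarrow> real" where
  "pq_num p q n = (p ^ n - q ^ n) / (p - q)"

definition pq_fact :: "real \<Rightarrow> real \<Rightarrow> nat \<Rightarrow> real" where
  "pq_fact p q n = (\<Prod>k=1..n. pq_num p q k)"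

definition pq_E :: "real \<Rightarrow> real \<Rightarrow> complex \<Rightarrow> complex" where
  "pq_E p q z = (\<Sum>n. of_real (q ^ (n choose 2) / pq_fact p q n) * z ^ n)"

text \<open>The power series with coefficients \<open>p ^ (n choose 2) / pq_fact p q n\<close> has radius of
  convergence \<open>p / (p - q)\<close>; outside the open disc the function is given by its meromorphic
  extension (with value \<open>0\<close> at the poles, by the convention on division by zero).\<close>

definition pq_e :: "real \<Rightarrow> real \<Rightarrow> complex \<Rightarrow> complex" where
  "pq_e p q z =
     (if norm z < p / (p - q)
      then (\<Sum>n. of_real (p ^ (n choose 2) / pq_fact p q n) * z ^ n)
      else 1 / pq_E p q (- z))"

definition pq_node :: "real \<Rightarrow> real \<Rightarrow> int \<Rightarrow> real" where
  "pq_node p q j = q powi j / p powi (j + 1)"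

text \<open>The bilateral series is split into the indices \<open>j \<ge> 0\<close> and \<open>j < 0\<close>, the latter being
  enumerated as \<open>- 1, - 2, \<dots>\<close>. Convergence of each half is ordinary, possibly conditional,
  convergence of the partial sums. The integral depends only on the values of \<open>f\<close> on the
  positive reals if \<open>0 < q < p\<close>.\<close>

definition pq_integrable :: "real \<Rightarrow> real \<Rightarrow> (real \<Rightarrow> complex) \<Rightarrow> bool" where
  "pq_integrable p q f \<longleftrightarrow>
     summable (\<lambda>j::nat. of_real (pq_node p q (int j)) * f (pq_node p q (int j))) \<and>
     summable (\<lambda>j::nat. of_real (pq_node p q (- int (Suc j))) * f (pq_node p q (- int (Suc j))))"

definition pq_integral :: "real \<Rightarrow> real \<Rightarrow> (real \<Rightarrow> complex) \<Rightarrow> complex" where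
  "pq_integral p q f =
     of_real (p - q) *
     ((\<Sum>j::nat. of_real (pq_node p q (int j)) * f (pq_node p q (int j))) +
      (\<Sum>j::nat. of_real (pq_node p q (- int (Suc j))) * f (pq_node p q (- int (Suc j)))))"

definition pq_laplace_converges :: "real \<Rightarrow> real \<Rightarrow> (real \<Rightarrow> complex) \<Rightarrow> real \<Rightarrow> bool" where
  "pq_laplace_converges p q f s \<longleftrightarrow>
     pq_integrable p q (\<lambda>t. f t * pq_e p q (of_real (- (p * t * s))))"

definition pq_laplace :: "real \<Rightarrow> real \<Rightarrow> (real \<Rightarrow> complex) \<Rightarrow> real \<Rightarrow> complex" where
  "pq_laplace p q f s = pq_integral p q (\<lambda>t. f t * pq_e p q (of_real (- (p * t * s))))"

definition pq_deriv :: "real \<Rightarrow> real \<Rightarrow> (real \<Rightarrow> complex) \<Rightarrow> real \<Rightarrow> complex" where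
  "pq_deriv p q g s = (g (p * s) - g (q * s)) / of_real ((p - q) * s)"

end

(* The series coefficients give e(qz) = (1 - (p - q) z) e(pz) and E(pz) = (1 + (p - q) z) E(qz).
   Hence z \<mapsto> e(z) E(-z) is invariant under z \<mapsto> (q/p) z, and continuity at 0 makes it
   equal to 1 on the disc of convergence; so e(-x) = 1/E(x) for all x \<ge> 0, and the functional
   equation of e holds on the whole negative axis. It says e(-pts) - e(-qts) = -(p - q) t s e(-pts),
   which turns the difference of the transforms of f at s and (q/p) s into the transform of t f(t)
   at s. The theorem follows by induction on n, since the iterated derivative commutes with the
   dilation by 1/p up to the factor p^(-n). *)

theory Submission
  imports Defs
begin

section \<open>The exponential functions\<close>

lemma pq_num_pos:
  assumes "0 < q" "q < p" "0 < n"
  shows "pq_num p q n > 0"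
  using assms power_strict_mono[of q p n] by (simp add: pq_num_def)

lemma pq_fact_pos:
  assumes "0 < q" "q < p"
  shows "pq_fact p q n > 0"
  unfolding pq_fact_def using assms by (intro prod_pos) (auto intro: pq_num_pos)

lemma pq_fact_Suc: "pq_fact p q (Suc n) = pq_fact p q n * pq_num p q (Suc n)"
  by (simp add: pq_fact_def)

lemma Suc_choose_2: "Suc n choose 2 = (n choose 2) + n"
  by (simp add: numeral_2_eq_2)

lemma pq_coeff_Suc:
  assumes "0 < q" "q < p"
  shows "r ^ (Suc n choose 2) / pq_fact p q (Suc n) =
    (p - q) * r ^ n / (p ^ Suc n - q ^ Suc n) * (r ^ (n choose 2) / pq_fact p q n)"
  by (simp only: pq_fact_Suc Suc_choose_2 pq_num_def power_add) (simp add: mult_ac)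

text \<open>One ratio test serves both exponentials, \<open>r = p\<close> for \<open>pq_e\<close>
  and \<open>r = q\<close> for \<open>pq_E\<close>. By \<open>pq_coeff_Suc\<close>, the sequence in
  \<open>lim\<close> consists of the quotients of the norms of consecutive terms.\<close>

lemma summable_pq_series:
  fixes z :: complex
  assumes "0 < q" "q < p" "0 < r"
    and lim: "(\<lambda>n. norm z * ((p - q) * r ^ n / (p ^ Suc n - q ^ Suc n))) \<longlonglongrightarrow> L" and "L < 1"
  shows "summable (\<lambda>n. of_real (r ^ (n choose 2) / pq_fact p q n) * z ^ n)"
proof -
  \<comment> \<open>The ratio test needs one bound below 1 for almost all quotients; any number
    strictly between \<open>L\<close> and 1 provides it.\<close>
  obtain M where M: "L < M" "M < 1"
    using \<open>L < 1\<close> dense by blast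
  then obtain N where N: "\<And>n. n \<ge> N \<Longrightarrow>
      norm z * ((p - q) * r ^ n / (p ^ Suc n - q ^ Suc n)) < M"
    using order_tendstoD(2)[OF lim] unfolding eventually_sequentially by blast
  show ?thesis
  proof (rule summable_ratio_test[OF \<open>M < 1\<close>])
    fix n assume "n \<ge> N"
    let ?a = "r ^ (n choose 2) / pq_fact p q n"
    let ?c = "(p - q) * r ^ n / (p ^ Suc n - q ^ Suc n)"
    have a: "?a > 0" using assms pq_fact_pos by simp
    have c: "?c > 0" using assms power_strict_mono[of q p "Suc n"] by simp
    have "norm (of_real (r ^ (Suc n choose 2) / pq_fact p q (Suc n)) * z ^ Suc n)
        = (norm z * ?c) * (?a * norm z ^ n)"
      unfolding pq_coeff_Suc[OF assms(1,2)] norm_mult norm_of_real norm_power abs_mult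
        abs_of_pos[OF a] abs_of_pos[OF c]
      by (simp only: power_Suc mult_ac)
    also have "\<dots> \<le> M * (?a * norm z ^ n)"
      using a
      by (intro mult_right_mono less_imp_le[OF N[OF \<open>n \<ge> N\<close>]] mult_nonneg_nonneg) auto
    also have "\<dots> = M * norm (of_real ?a * z ^ n)"
      by (simp only: norm_mult norm_power norm_of_real abs_of_pos[OF a])
    finally show "norm (of_real (r ^ (Suc n choose 2) / pq_fact p q (Suc n)) * z ^ Suc n)
        \<le> M * norm (of_real ?a * z ^ n)" .
  qed
qed

text \<open>Dividing by \<open>p ^ n\<close> expresses the quotients through
  \<open>(q / p) ^ n\<close>, which tends to 0, so that their limits can be read off.\<close>

lemma ratio_denominator:
  fixes p q :: real
  assumes "p \<noteq> 0"
  shows "p - q * (q / p) ^ n = (p ^ Suc n - q ^ Suc n) / p ^ n"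
  using assms by (simp add: power_divide diff_divide_distrib)

lemma ratio_power_tendsto_zero:
  fixes p q :: real
  assumes "0 < q" "q < p"
  shows "(\<lambda>n. (q / p) ^ n) \<longlonglongrightarrow> 0"
  using assms by (intro LIMSEQ_power_zero) auto

lemma summable_pq_e:
  fixes z :: complex
  assumes "0 < q" "q < p" "norm z < p / (p - q)"
  shows "summable (\<lambda>n. of_real (p ^ (n choose 2) / pq_fact p q n) * z ^ n)"
proof (rule summable_pq_series)
  have "(\<lambda>n. norm z * ((p - q) / (p - q * (q / p) ^ n))) \<longlonglongrightarrow> norm z * ((p - q) / (p - q * 0))"
    using assms by (intro tendsto_intros ratio_power_tendsto_zero) auto
  moreover have "(p - q) / (p - q * (q / p) ^ n) = (p - q) * p ^ n / (p ^ Suc n - q ^ Suc n)" for n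
    using assms by (subst ratio_denominator) (auto simp: power_divide)
  ultimately show "(\<lambda>n. norm z * ((p - q) * p ^ n / (p ^ Suc n - q ^ Suc n)))
      \<longlonglongrightarrow> norm z * ((p - q) / (p - q * 0))"
    by simp
  \<comment> \<open>The limit is \<open>norm z * (p - q) / p\<close>, which is below 1 exactly on
    the disc of convergence.\<close>
  show "norm z * ((p - q) / (p - q * 0)) < 1"
    using assms by (simp add: field_simps)
qed (use assms in auto)

lemma summable_pq_E:
  fixes z :: complex
  assumes "0 < q" "q < p"
  shows "summable (\<lambda>n. of_real (q ^ (n choose 2) / pq_fact p q n) * z ^ n)"
proof (rule summable_pq_series)
  \<comment> \<open>With \<open>r = q\<close> a factor \<open>(q / p) ^ n\<close> survives in the
    numerator, so the limit is 0 for every \<open>z\<close>.\<close>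
  have "(\<lambda>n. norm z * ((p - q) * (q / p) ^ n / (p - q * (q / p) ^ n)))
      \<longlonglongrightarrow> norm z * ((p - q) * 0 / (p - q * 0))"
    using assms by (intro tendsto_intros ratio_power_tendsto_zero) auto
  moreover have "(p - q) * (q / p) ^ n / (p - q * (q / p) ^ n)
      = (p - q) * q ^ n / (p ^ Suc n - q ^ Suc n)" for n
    using assms by (subst ratio_denominator) (auto simp: power_divide)
  ultimately show "(\<lambda>n. norm z * ((p - q) * q ^ n / (p ^ Suc n - q ^ Suc n)))
      \<longlonglongrightarrow> norm z * ((p - q) * 0 / (p - q * 0))"
    by simp
qed (use assms in auto)

section \<open>Dilation equations of the exponentials\<close>

text \<open>In the difference, the factor \<open>p ^ Suc n - q ^ Suc n\<close> cancels against the
  last factor of the factorial. What remains is the series shifted by one index, and the leftover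
  \<open>r ^ n\<close> becomes a dilation of the argument by \<open>r\<close>.\<close>

lemma pq_series_difference:
  fixes z :: complex and p q r :: real
  defines "S \<equiv> \<lambda>w. \<Sum>n. of_real (r ^ (n choose 2) / pq_fact p q n) * w ^ n"
  assumes pq: "0 < q" "q < p"
    and sp: "summable (\<lambda>n. of_real (r ^ (n choose 2) / pq_fact p q n) * (of_real p * z) ^ n)"
    and sq: "summable (\<lambda>n. of_real (r ^ (n choose 2) / pq_fact p q n) * (of_real q * z) ^ n)"
    and sr: "summable (\<lambda>n. of_real (r ^ (n choose 2) / pq_fact p q n) * (of_real r * z) ^ n)"
  shows "S (of_real p * z) - S (of_real q * z) = of_real (p - q) * z * S (of_real r * z)"
proof -
  define a where "a n = r ^ (n choose 2) / pq_fact p q n" for n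
  define h where "h n = of_real (a n) * (of_real p * z) ^ n - of_real (a n) * (of_real q * z) ^ n"
    for n
  have a_Suc: "a (Suc n) * (p ^ Suc n - q ^ Suc n) = (p - q) * r ^ n * a n" for n
  proof -
    have "p ^ Suc n - q ^ Suc n \<noteq> 0"
      using power_strict_mono[of q p "Suc n"] pq by simp
    moreover have "x / d * y * d = x * y" if "d \<noteq> 0" for x y d :: real
      using that by simp
    ultimately show ?thesis
      unfolding a_def pq_coeff_Suc[OF pq] by blast
  qed
  have h_Suc: "h (Suc n) = of_real (p - q) * z * (of_real (a n) * (of_real r * z) ^ n)" for n
  proof -
    have "h (Suc n) = of_real (a (Suc n) * (p ^ Suc n - q ^ Suc n)) * z ^ Suc n"
      unfolding h_def power_mult_distrib
      by (simp only: of_real_mult of_real_diff of_real_power left_diff_distrib right_diff_distrib mult.assoc)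
    also have "\<dots> = of_real (p - q) * z * (of_real (a n) * (of_real r * z) ^ n)"
      unfolding a_Suc power_mult_distrib by (simp only: of_real_mult of_real_power power_Suc mult_ac)
    finally show ?thesis .
  qed
  have h: "summable h"
    unfolding h_def a_def by (intro summable_diff sp sq)
  have "S (of_real p * z) - S (of_real q * z) = suminf h"
    unfolding S_def h_def a_def by (rule suminf_diff[OF sp sq])
  \<comment> \<open>The constant terms cancel, so the sum may start at index 1.\<close>
  also have "\<dots> = (\<Sum>n. h (Suc n))"
  proof -
    have "h 0 = 0" by (simp add: h_def)
    then show ?thesis using suminf_split_head[OF h] by simp
  qed
  also have "\<dots> = of_real (p - q) * z * S (of_real r * z)"
    unfolding h_Suc S_def a_def by (rule suminf_mult[OF sr])
  finally show ?thesis .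
qed

lemma pq_E_dilation:
  assumes "0 < q" "q < p"
  shows "pq_E p q (of_real p * z) = (1 + of_real (p - q) * z) * pq_E p q (of_real q * z)"
proof -
  have "pq_E p q (of_real p * z) - pq_E p q (of_real q * z)
      = of_real (p - q) * z * pq_E p q (of_real q * z)"
    unfolding pq_E_def by (intro pq_series_difference assms summable_pq_E)
  then show ?thesis by (simp add: algebra_simps)
qed

lemma pq_e_dilation_disc:
  assumes "0 < q" "q < p" and z: "norm (of_real p * z) < p / (p - q)"
  shows "pq_e p q (of_real q * z) = (1 - of_real (p - q) * z) * pq_e p q (of_real p * z)"
proof -
  have "q * norm z \<le> p * norm z"
    using assms by (intro mult_right_mono) auto
  then have z': "norm (of_real q * z) < p / (p - q)"
    using assms by (simp add: norm_mult)
  have "pq_e p q (of_real p * z) - pq_e p q (of_real q * z)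
      = of_real (p - q) * z * pq_e p q (of_real p * z)"
    unfolding pq_e_def if_P[OF z] if_P[OF z']
    by (intro pq_series_difference assms summable_pq_e z')
  then show ?thesis by (simp add: algebra_simps)
qed

section \<open>The two exponentials as reciprocals\<close>

lemma pq_e_mult_pq_E:
  assumes pq: "0 < q" "q < p" and z: "norm z < p / (p - q)"
  shows "pq_e p q z * pq_E p q (- z) = 1"
proof -
  \<comment> \<open>\<open>pq_e\<close> is defined by cases; the bare power series agrees with it on
    the disc and is directly seen to be continuous at 0.\<close>
  define S where "S w = (\<Sum>n. of_real (p ^ (n choose 2) / pq_fact p q n) * w ^ n)" for w :: complex
  define u where "u = q / p"
  have u: "0 < u" "u < 1"
    using pq by (auto simp: u_def)
  define zs where "zs n = of_real (u ^ n) * z" for n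
  have disc: "norm (zs n) < p / (p - q)" for n
  proof -
    have "norm (zs n) = u ^ n * norm z"
      using u by (simp add: zs_def norm_mult norm_power)
    also have "\<dots> \<le> 1 * norm z"
      using u by (intro mult_right_mono power_le_one) auto
    finally show ?thesis using z by simp
  qed
  have e_S: "pq_e p q (zs n) = S (zs n)" for n
    using disc by (simp add: pq_e_def S_def)
  have step: "S (zs (Suc n)) * pq_E p q (- zs (Suc n)) = S (zs n) * pq_E p q (- zs n)" for n
  proof -
    \<comment> \<open>Dilating \<open>w\<close> by \<open>p\<close> and by \<open>q\<close> gives
      two consecutive points of the sequence. The factor \<open>1 - (p - q) w\<close> gained by
      \<open>S\<close> in passing to the next point is lost by \<open>pq_E\<close>.\<close>
    define w where "w = zs n / of_real p"
    have w: "of_real p * w = zs n" "of_real q * w = zs (Suc n)"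
      using pq by (auto simp: w_def zs_def u_def)
    have "S (zs (Suc n)) = (1 - of_real (p - q) * w) * S (zs n)"
      using pq_e_dilation_disc[OF pq, of w] disc by (simp add: w e_S)
    moreover have "pq_E p q (- zs n) = (1 - of_real (p - q) * w) * pq_E p q (- zs (Suc n))"
      using pq_E_dilation[OF pq, of "- w"] by (simp add: w)
    ultimately show ?thesis by (simp only: mult_ac)
  qed
  have const: "S (zs n) * pq_E p q (- zs n) = S z * pq_E p q (- z)" for n
    by (induction n) (use step in \<open>auto simp: zs_def\<close>)
  have "zs \<longlonglongrightarrow> of_real 0 * z"
    unfolding zs_def using u by (intro tendsto_intros LIMSEQ_power_zero) auto
  then have zs: "zs \<longlonglongrightarrow> 0" by simp
  have S_cont: "isCont S 0"
    unfolding S_def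
  proof (rule isCont_powser)
    \<comment> \<open>Continuity at 0 follows from summability at any nonzero point; half the radius
      of convergence is such a point.\<close>
    show "summable (\<lambda>n. of_real (p ^ (n choose 2) / pq_fact p q n) *
        (of_real (p / (2 * (p - q))) :: complex) ^ n)"
    proof (rule summable_pq_e[OF pq])
      show "norm (of_real (p / (2 * (p - q))) :: complex) < p / (p - q)"
        unfolding norm_of_real using pq by (simp add: divide_strict_left_mono)
    qed
  qed (use pq in auto)
  have E_cont: "isCont (pq_E p q) 0"
    unfolding pq_E_def [abs_def]
    by (rule isCont_powser[OF summable_pq_E[OF pq, of 1]]) simp
  have "(\<lambda>n. - zs n) \<longlonglongrightarrow> 0"
    using tendsto_minus[OF zs] by simp
  then have "(\<lambda>n. S (zs n) * pq_E p q (- zs n)) \<longlonglongrightarrow> S 0 * pq_E p q 0"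
    by (intro tendsto_mult isCont_tendsto_compose[OF S_cont zs] isCont_tendsto_compose[OF E_cont])
  moreover have "S 0 * pq_E p q 0 = 1"
    unfolding S_def pq_E_def powser_zero by (simp add: pq_fact_def numeral_2_eq_2)
  ultimately have "S z * pq_E p q (- z) = 1"
    unfolding const using LIMSEQ_unique tendsto_const by metis
  then show ?thesis using z by (simp add: pq_e_def S_def)
qed

lemma pq_e_eq_inverse_pq_E:
  assumes "0 < q" "q < p"
  shows "pq_e p q z = 1 / pq_E p q (- z)"
proof (cases "norm z < p / (p - q)")
  case True
  then show ?thesis
    using pq_e_mult_pq_E[OF assms True] by (metis mult_zero_right nonzero_eq_divide_eq zero_neq_one)
qed (simp add: pq_e_def)

text \<open>For \<open>x \<ge> 0\<close> the factor \<open>1 + (p - q) x\<close> is positive and can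
  be cancelled after passing to reciprocals in \<open>pq_E_dilation\<close>. As \<open>pq_E\<close>
  is entire, this reaches beyond the disc of the series of \<open>pq_e\<close>.\<close>

lemma pq_e_difference:
  assumes pq: "0 < q" "q < p" and x: "0 \<le> x"
  shows "pq_e p q (of_real (- (p * x))) - pq_e p q (of_real (- (q * x)))
    = - of_real ((p - q) * x) * pq_e p q (of_real (- (p * x)))"
proof -
  have "1 + (p - q) * x > 0"
    using pq x by (intro add_pos_nonneg) auto
  then have nz: "1 + of_real (p - q) * of_real x \<noteq> (0::complex)"
    by (metis less_irrefl of_real_1 of_real_add of_real_eq_0_iff of_real_mult)
  have "pq_e p q (of_real (- (q * x)))
      = (1 + of_real (p - q) * of_real x) * pq_e p q (of_real (- (p * x)))"
    using nz pq_E_dilation[OF pq, of "of_real x"]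
    by (simp add: pq_e_eq_inverse_pq_E[OF pq])
  then show ?thesis by (simp add: algebra_simps)
qed

section \<open>The Laplace transform\<close>

lemma pq_node_pos:
  assumes "0 < q" "q < p"
  shows "pq_node p q j > 0"
  using assms by (simp add: pq_node_def)

text \<open>All nodes are positive. This is what lets the kernel identity, proved for positive
  \<open>t\<close> only, pass under the integral.\<close>

lemma pq_integral_cong:
  assumes "0 < q" "q < p" and "\<And>t. 0 < t \<Longrightarrow> f t = g t"
  shows "pq_integrable p q f \<longleftrightarrow> pq_integrable p q g" "pq_integral p q f = pq_integral p q g"
  using assms pq_node_pos by (simp_all add: pq_integrable_def pq_integral_def)

lemma pq_integral_cmult_diff:
  assumes "pq_integrable p q f" "pq_integrable p q g"
  shows "pq_integrable p q (\<lambda>t. c * (f t - g t))"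
    and "pq_integral p q (\<lambda>t. c * (f t - g t)) = c * (pq_integral p q f - pq_integral p q g)"
proof -
  let ?t = "\<lambda>h j. of_real (pq_node p q j) * h (pq_node p q j) :: complex"
  have eq: "?t (\<lambda>t. c * (f t - g t)) j = c * (?t f j - ?t g j)" for j
    by (simp add: algebra_simps)
  \<comment> \<open>\<open>\<nu>\<close> stands for either enumeration of indices,
    \<open>int j\<close> or \<open>- int (Suc j)\<close>. Working with \<open>sums\<close> yields
    convergence and value of each half at once.\<close>
  have sums: "(\<lambda>j::nat. ?t (\<lambda>t. c * (f t - g t)) (\<nu> j)) sums
      (c * ((\<Sum>j. ?t f (\<nu> j)) - (\<Sum>j. ?t g (\<nu> j))))"
    if "summable (\<lambda>j. ?t f (\<nu> j))" "summable (\<lambda>j. ?t g (\<nu> j))" for \<nu>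
    unfolding eq using that by (intro sums_mult sums_diff summable_sums)
  note summable = assms[unfolded pq_integrable_def]
  note pos = sums[OF summable[THEN conjunct1]] and neg = sums[OF summable[THEN conjunct2]]
  show "pq_integrable p q (\<lambda>t. c * (f t - g t))"
    unfolding pq_integrable_def using pos neg by (blast intro: sums_summable)
  show "pq_integral p q (\<lambda>t. c * (f t - g t)) = c * (pq_integral p q f - pq_integral p q g)"
    unfolding pq_integral_def pos[THEN sums_unique, symmetric] neg[THEN sums_unique, symmetric]
    by (simp add: algebra_simps)
qed

section \<open>Multiplication by t under the transform\<close>

lemma pq_laplace_times_t:
  assumes pq: "0 < q" "q < p" and s: "0 < s"
    and conv: "pq_laplace_converges p q g s" "pq_laplace_converges p q g (q / p * s)"
  shows "pq_laplace_converges p q (\<lambda>t. of_real t * g t) s"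
    and "pq_laplace p q (\<lambda>t. of_real t * g t) s
      = - (pq_laplace p q g s - pq_laplace p q g (q / p * s)) / of_real ((p - q) * s)"
proof -
  \<comment> \<open>The difference of the kernels carries the factor
    \<open>- (p - q) * t * s\<close>; multiplication by \<open>c\<close> reduces it to
    \<open>t\<close>.\<close>
  define c :: complex where "c = - 1 / of_real ((p - q) * s)"
  let ?G = "\<lambda>\<sigma> t. g t * pq_e p q (of_real (- (p * t * \<sigma>)))"
  have cs: "c * of_real ((p - q) * s) = - 1"
    using pq s by (simp add: c_def)
  have eq: "of_real t * g t * pq_e p q (of_real (- (p * t * s)))
      = c * (?G s t - ?G (q / p * s) t)" if "0 < t" for t
  proof -
    \<comment> \<open>The kernel at \<open>q / p * s\<close> thus has argument \<open>- q x\<close>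
      with \<open>x = t * s\<close>, so \<open>pq_e_difference\<close> applies.\<close>
    have "p * t * (q / p * s) = q * (t * s)"
      using pq by simp
    then have "c * (?G s t - ?G (q / p * s) t)
        = c * g t * (pq_e p q (of_real (- (p * (t * s)))) - pq_e p q (of_real (- (q * (t * s)))))"
      by (simp add: right_diff_distrib mult.assoc)
    also have "\<dots> = - (c * of_real ((p - q) * s)) * of_real t * g t *
        pq_e p q (of_real (- (p * (t * s))))"
      using pq_e_difference[OF pq, of "t * s"] that s
      by (simp only: less_imp_le mult_nonneg_nonneg) (simp add: algebra_simps)
    finally show ?thesis unfolding cs by (simp add: mult.assoc)
  qed
  note * = pq_integral_cmult_diff[OF conv[unfolded pq_laplace_converges_def], of c]
  note ** = pq_integral_cong[OF pq eq]
  show "pq_laplace_converges p q (\<lambda>t. of_real t * g t) s"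
    unfolding pq_laplace_converges_def using *(1) **(1) by simp
  have "pq_laplace p q (\<lambda>t. of_real t * g t) s
      = c * (pq_laplace p q g s - pq_laplace p q g (q / p * s))"
    unfolding pq_laplace_def using *(2) **(2) by simp
  then show "pq_laplace p q (\<lambda>t. of_real t * g t) s
      = - (pq_laplace p q g s - pq_laplace p q g (q / p * s)) / of_real ((p - q) * s)"
    by (simp only: c_def times_divide_eq_left mult_minus1)
qed

section \<open>Iterated derivatives and the induction on n\<close>

text \<open>Each derivative divides by its variable, so every application to a dilated function
  releases one factor \<open>c\<close>.\<close>

lemma pq_deriv_funpow_dilation:
  assumes "c \<noteq> 0"
  shows "(pq_deriv p q ^^ n) (\<lambda>x. g (c * x)) = (\<lambda>x. of_real c ^ n * (pq_deriv p q ^^ n) g (c * x))"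
proof (induction n)
  case (Suc n)
  have "pq_deriv p q (\<lambda>x. of_real c ^ n * G (c * x))
      = (\<lambda>x. of_real c ^ Suc n * pq_deriv p q G (c * x))" for G
    using assms
    by (simp add: pq_deriv_def fun_eq_iff mult.left_commute[of c] right_diff_distrib[symmetric])
  then show ?case
    by (simp only: funpow.simps comp_def Suc)
qed simp

theorem theorem3p16:
  fixes p q s :: real and n :: nat and f :: "real \<Rightarrow> complex"
  assumes "0 < q" and "q < p" and "0 < s"
    and "\<And>k. k \<le> n \<Longrightarrow> pq_laplace_converges p q f ((q / p) ^ k * s)"
  shows "pq_laplace_converges p q (\<lambda>t. of_real t ^ n * f t) s \<and>
         pq_laplace p q (\<lambda>t. of_real t ^ n * f t) s =
           (- 1) ^ n * of_real (p ^ (n choose 2)) *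
           (pq_deriv p q ^^ n) (\<lambda>\<sigma>. pq_laplace p q f (p powi (- int n) * \<sigma>)) s"
  using assms(3,4)
\<comment> \<open>The hypothesis for \<open>n\<close> is applied at two points, \<open>s\<close> and
  \<open>q / p * s\<close>.\<close>
proof (induction n arbitrary: s)
  case 0
  from "0.prems"(2)[of 0] show ?case by (simp add: numeral_2_eq_2)
next
  case (Suc n)
  have p: "p > 0" using assms by simp
  define g where "g t = of_real t ^ n * f t" for t
  define H where "H = (pq_deriv p q ^^ n) (\<lambda>\<sigma>. pq_laplace p q f (p powi (- int n) * \<sigma>))"
  define A :: complex where "A = (- 1) ^ n * of_real (p ^ (n choose 2))"
  \<comment> \<open>The first \<open>n + 1\<close> points starting from \<open>q / p * s\<close> are
    those from \<open>s\<close> with exponent raised by one, hence at most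
    \<open>Suc n\<close>.\<close>
  have conv': "pq_laplace_converges p q f ((q / p) ^ k * (q / p * s))" if "k \<le> n" for k
    using Suc.prems(2)[of "Suc k"] that by (simp add: mult_ac)
  have at_s: "pq_laplace_converges p q g s" "pq_laplace p q g s = A * H s"
    using Suc.IH[of s] Suc.prems unfolding g_def H_def A_def by auto
  have at_qs: "pq_laplace_converges p q g (q / p * s)"
      "pq_laplace p q g (q / p * s) = A * H (q / p * s)"
    using Suc.IH[of "q / p * s"] conv' Suc.prems(1) assms p unfolding g_def H_def A_def by auto
  have tg: "of_real t ^ Suc n * f t = of_real t * g t" for t
    by (simp add: g_def)
  \<comment> \<open>The extra factor \<open>1 / p\<close> is split off as a dilation, which the
    \<open>n\<close> inner derivatives turn into the factor \<open>inverse p ^ n\<close>.\<close>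
  have powi: "p powi (- int (Suc n)) * \<sigma> = p powi (- int n) * (inverse p * \<sigma>)" for \<sigma>
    using p by (simp add: power_int_minus del: of_nat_Suc)
  have "(pq_deriv p q ^^ Suc n) (\<lambda>\<sigma>. pq_laplace p q f (p powi (- int (Suc n)) * \<sigma>)) s
      = pq_deriv p q (\<lambda>\<sigma>. of_real (inverse p) ^ n * H (inverse p * \<sigma>)) s"
    unfolding powi funpow.simps comp_def H_def
    using pq_deriv_funpow_dilation[where c = "inverse p" and
        g = "\<lambda>\<sigma>. pq_laplace p q f (p powi (- int n) * \<sigma>)"] p by simp
  \<comment> \<open>The outer derivative evaluates at \<open>p * s\<close> and \<open>q * s\<close>;
    the dilation moves these to \<open>s\<close> and \<open>q / p * s\<close>.\<close>
  also have "\<dots> = of_real (inverse p) ^ n * (H s - H (q / p * s)) / of_real ((p - q) * s)"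
    using p by (simp add: pq_deriv_def right_diff_distrib field_simps)
  finally have deriv: "(pq_deriv p q ^^ Suc n)
      (\<lambda>\<sigma>. pq_laplace p q f (p powi (- int (Suc n)) * \<sigma>)) s
      = of_real (inverse p) ^ n * (H s - H (q / p * s)) / of_real ((p - q) * s)" .
  \<comment> \<open>The binomial exponent grows by \<open>n\<close>, and this \<open>p ^ n\<close>
    cancels the factor from the dilation.\<close>
  have factor: "(- 1) ^ Suc n * of_real (p ^ (Suc n choose 2)) * of_real (inverse p) ^ n = - A"
    using p unfolding Suc_choose_2 A_def by (simp add: power_add power_inverse field_simps)
  have "pq_laplace p q (\<lambda>t. of_real t * g t) s
      = - A * (H s - H (q / p * s)) / of_real ((p - q) * s)"
    using pq_laplace_times_t(2)[OF assms(1,2) Suc.prems(1) at_s(1) at_qs(1)] at_s(2) at_qs(2)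
    by (simp add: algebra_simps)
  also have "\<dots> = (- 1) ^ Suc n * of_real (p ^ (Suc n choose 2)) *
      (of_real (inverse p) ^ n * (H s - H (q / p * s)) / of_real ((p - q) * s))"
    unfolding factor[symmetric] by (simp only: mult.assoc times_divide_eq_right)
  finally show ?case
    unfolding tg deriv
    using pq_laplace_times_t(1)[OF assms(1,2) Suc.prems(1) at_s(1) at_qs(1)] by blast
qed

end
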